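(* Let $B$ and $D$ be independent exponential random variables with rates $\mu$ and $\nu$, respectively. For any $z(0)\in[0,K]$, the fluid-model solution $z(\cdot)$ with initial value $z(0)$ satisfies $z(t)\to z^*$ exponentially fast as $t\to\infty$. In addition, $z^*$ is given by the unique positive solution of the fixed-point equation $$z^*=\min\{\lambda,\nu K\}\;\mathbb{E}\Big[\min\Big\{D,\;B\max\Big\{1,\frac{z^*}{M}\Big\}\Big\}\Big].$$
   Context: A charging station has $K>0$ parking spaces and power capacity $M$ with $0<M\le K$. Vehicles arrive according to a Poisson process with rate $\lambda>0$ and have a random charging requirement $B$ (exponential with rate $\mu>0$) and a random parking time $D$ (exponential with rate $\nu>0$). The fluid model describes the number of not fully charged vehicles in the station. A continuous function $z:\mathbb{R}_+\to[0,K]$ is called a fluid-model solution if it satisfies the ODE $$z'(t)=\min\{\lambda,\nu K\}-\nu z(t)-\mu\min\{z(t),M\}$$ for $t\in[0,t^* )$, where $t^*=\inf\{s\ge 0: z(s)=0\}$, and $z(t)\equiv 0$ for $t\ge t^*$.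
   Formalization: For z(0)=0 the definition gives t*=0 and z identically 0, which does not converge to z*>0; in that case the formal statement instead takes a trajectory in [0,K] that solves the ODE for all t≥0. For z(0) in (0,K] the definition is used as stated. *)

theory Defs
  imports "HOL-Probability.Probability"
begin

definition fluid_drift :: "real \<Rightarrow> real \<Rightarrow> real \<Rightarrow> real \<Rightarrow> real \<Rightarrow> real \<Rightarrow> real" where
  "fluid_drift K M lam \<mu> \<nu> x = min lam (\<nu> * K) - \<nu> * x - \<mu> * min x M"

text \<open>Trajectories are functions on \<open>[0,\<infinity>)\<close>; their values at negative arguments are irrelevant.\<close>

definition fluid_path :: "real \<Rightarrow> (real \<Rightarrow> real) \<Rightarrow> bool" where
  "fluid_path K z \<longleftrightarrow> continuous_on {0..} z \<and> (\<forall>t\<ge>0. z t \<in> {0..K})"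

text \<open>The derivative at time 0 is one-sided; at \<open>t > 0\<close> the filter \<open>at t within {0..}\<close> is \<open>at t\<close>.\<close>

definition satisfies_fluid_ode_until ::
  "real \<Rightarrow> real \<Rightarrow> real \<Rightarrow> real \<Rightarrow> real \<Rightarrow> (real \<Rightarrow> real) \<Rightarrow> ereal \<Rightarrow> bool" where
  "satisfies_fluid_ode_until K M lam \<mu> \<nu> z T \<longleftrightarrow>
     (\<forall>t\<ge>0. ereal t < T \<longrightarrow>
        (z has_real_derivative fluid_drift K M lam \<mu> \<nu> (z t)) (at t within {0..}))"

text \<open>Taken in the extended reals, so that the infimum of the empty set is \<open>\<infinity>\<close>.\<close>

definition zero_hitting_time :: "(real \<Rightarrow> real) \<Rightarrow> ereal" where
  "zero_hitting_time z = Inf (ereal ` {s. 0 \<le> s \<and> z s = 0})"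

definition fluid_model_solution ::
  "real \<Rightarrow> real \<Rightarrow> real \<Rightarrow> real \<Rightarrow> real \<Rightarrow> (real \<Rightarrow> real) \<Rightarrow> bool" where
  "fluid_model_solution K M lam \<mu> \<nu> z \<longleftrightarrow>
     fluid_path K z \<and>
     satisfies_fluid_ode_until K M lam \<mu> \<nu> z (zero_hitting_time z) \<and>
     (\<forall>t\<ge>0. zero_hitting_time z \<le> ereal t \<longrightarrow> z t = 0)"

text \<open>
  A trajectory with \<open>z 0 = 0\<close> has hitting time 0, so the only fluid-model solution starting
  at 0 is the zero function, although it does not solve the differential equation.
  This degenerate path does not converge to the positive equilibrium. Starting from 0,
  the trajectory is therefore required to follow the differential equation at all times.
\<close>

lemma fluid_model_solution_starting_at_zero:
  assumes "fluid_model_solution K M lam \<mu> \<nu> z" "z 0 = 0" "0 \<le> t"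
  shows "z t = 0"
proof -
  have "zero_hitting_time z \<le> ereal 0"
    unfolding zero_hitting_time_def using assms(2) by (intro Inf_lower) auto
  also have "\<dots> \<le> ereal t"
    using assms(3) by simp
  finally show ?thesis
    using assms(1,3) by (simp add: fluid_model_solution_def)
qed

definition fluid_trajectory_from ::
  "real \<Rightarrow> real \<Rightarrow> real \<Rightarrow> real \<Rightarrow> real \<Rightarrow> real \<Rightarrow> (real \<Rightarrow> real) \<Rightarrow> bool" where
  "fluid_trajectory_from K M lam \<mu> \<nu> z0 z \<longleftrightarrow>
     z 0 = z0 \<and>
     (if z0 = 0 then fluid_path K z \<and> satisfies_fluid_ode_until K M lam \<mu> \<nu> z \<infinity>
      else fluid_model_solution K M lam \<mu> \<nu> z)"

definition converges_exponentially :: "(real \<Rightarrow> real) \<Rightarrow> real \<Rightarrow> bool" where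
  "converges_exponentially z L \<longleftrightarrow>
     (\<exists>C c. c > 0 \<and> (\<forall>t\<ge>0. \<bar>z t - L\<bar> \<le> C * exp (- c * t)))"

end

theory Submission
  imports Defs
begin

text \<open>
  Scaling the exponential variable \<open>B\<close> by \<open>c > 0\<close> gives an exponential variable of rate \<open>\<mu> / c\<close>,
  and the minimum of independent exponentials is exponential with the sum of the rates. Hence the
  expectation in the fixed-point equation equals \<open>1 / (\<nu> + \<mu> / max 1 (y / M))\<close>. Since
  \<open>y / max 1 (y / M) = min y M\<close> for \<open>y > 0\<close>, the fixed points are exactly the positive zeros of the
  drift of the fluid model. The drift is strictly decreasing, positive at \<open>0\<close> and negative for
  large arguments, so it has exactly one zero \<open>z\<^sup>*\<close>, which is positive.

  Convergence comes from a one-sided Lipschitz bound: \<open>x \<mapsto> - \<mu> * min x M\<close> is nonincreasing,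
  so the drift decreases with slope at most \<open>- \<nu>\<close>. Along a solution the quantity
  \<open>(z t - z\<^sup>*)\<^sup>2 * exp (2 * \<nu> * t)\<close> is therefore nonincreasing, which gives
  \<open>\<bar>z t - z\<^sup>*\<bar> \<le> \<bar>z 0 - z\<^sup>*\<bar> * exp (- \<nu> * t)\<close>.

  For \<open>z 0 > 0\<close> the differential equation is only imposed up to the first zero of \<open>z\<close>, so it must
  be shown that \<open>z\<close> never vanishes. As long as the equation holds,
  \<open>z' \<ge> - (\<nu> + \<mu>) * z\<close>, so \<open>z t * exp ((\<nu> + \<mu>) * t)\<close> is nondecreasing and remains at least
  \<open>z 0 > 0\<close>, up to and including the supposed hitting time.
\<close>

section \<open>The fixed-point equation\<close>

lemma (in prob_space) exponential_distributed_scale: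
  fixes X :: "'a \<Rightarrow> real"
  assumes X: "distributed M lborel X (exponential_density l)" and "0 < l" "0 < c"
  shows "distributed M lborel (\<lambda>x. X x * c) (exponential_density (l / c))"
proof (subst exponential_distributed_iff, safe)
  show "0 < l / c"
    using assms by simp
  show "random_variable borel (\<lambda>x. X x * c)"
    using distributed_measurable[OF X] by simp
  fix a :: real assume "0 \<le> a"
  have "\<P>(x in M. X x * c \<le> a) = \<P>(x in M. X x \<le> a / c)"
    using \<open>0 < c\<close> by (simp add: pos_le_divide_eq)
  also have "\<dots> = 1 - exp (- (a / c) * l)"
    using exponential_distributedD_le[OF X _ \<open>0 < l\<close>, of "a / c"] \<open>0 \<le> a\<close> \<open>0 < c\<close> by simp
  finally show "\<P>(x in M. X x * c \<le> a) = 1 - exp (- a * (l / c))"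
    by simp
qed

lemma (in prob_space) expectation_min_scaled_exponential:
  fixes B D :: "'a \<Rightarrow> real"
  assumes "0 < \<mu>" "0 < \<nu>" "0 < c"
    and B: "distributed M lborel B (exponential_density \<mu>)"
    and D: "distributed M lborel D (exponential_density \<nu>)"
    and ind: "indep_var borel B borel D"
  shows "(\<integral>\<omega>. min (D \<omega>) (B \<omega> * c) \<partial>M) = 1 / (\<nu> + \<mu> / c)"
proof -
  have "indep_var borel ((\<lambda>b. b * c) \<circ> B) borel ((\<lambda>d. d) \<circ> D)"
    by (rule indep_var_compose[OF ind]) auto
  then have "indep_var borel (\<lambda>\<omega>. B \<omega> * c) borel D"
    by (simp add: comp_def)
  then have "distributed M lborel (\<lambda>\<omega>. min (B \<omega> * c) (D \<omega>)) (exponential_density (\<mu> / c + \<nu>))"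
    using assms by (intro exponential_distributed_min exponential_distributed_scale) auto
  then have "expectation (\<lambda>\<omega>. min (B \<omega> * c) (D \<omega>)) = 1 / (\<mu> / c + \<nu>)"
    using assms by (intro exponential_distributed_expectation add_pos_pos divide_pos_pos)
  then show ?thesis
    by (simp add: min.commute add.commute)
qed

lemma div_max_1_eq_min:
  fixes y M :: real
  assumes "0 < y" "0 < M"
  shows "y / max 1 (y / M) = min y M"
  using assms by (cases "y \<le> M") (auto simp: max_def min_def field_simps)

lemma fixed_point_iff_fluid_drift_zero:
  assumes "0 < M" "0 < \<mu>" "0 < \<nu>" "0 < y"
  shows "y = min lam (\<nu> * K) * (1 / (\<nu> + \<mu> / max 1 (y / M))) \<longleftrightarrow>
         fluid_drift K M lam \<mu> \<nu> y = 0"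
proof -
  define c where "c = max 1 (y / M)"
  have "0 < \<nu> + \<mu> / c"
    using assms by (intro add_pos_pos divide_pos_pos) (auto simp: c_def)
  then have "y = min lam (\<nu> * K) * (1 / (\<nu> + \<mu> / c)) \<longleftrightarrow>
      min lam (\<nu> * K) = \<nu> * y + \<mu> * (y / c)"
    by (auto simp: nonzero_eq_divide_eq algebra_simps)
  also have "y / c = min y M"
    unfolding c_def using assms by (simp only: div_max_1_eq_min)
  finally show ?thesis
    by (auto simp: c_def fluid_drift_def)
qed

section \<open>The drift and its equilibrium\<close>

lemma fluid_drift_diff_le:
  assumes "0 \<le> \<mu>" "x \<le> y"
  shows "fluid_drift K M lam \<mu> \<nu> y - fluid_drift K M lam \<mu> \<nu> x \<le> - \<nu> * (y - x)"
proof -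
  have "\<mu> * min x M \<le> \<mu> * min y M"
    using assms by (intro mult_left_mono) auto
  then show ?thesis
    by (simp add: fluid_drift_def algebra_simps)
qed

text \<open>
  The product form of the preceding bound covers both orderings of \<open>x\<close> and \<open>y\<close>; it is the form
  in which the bound enters the derivative of the squared distance to the equilibrium.
\<close>
lemma fluid_drift_one_sided_Lipschitz:
  assumes "0 \<le> \<mu>"
  shows "(x - y) * (fluid_drift K M lam \<mu> \<nu> x - fluid_drift K M lam \<mu> \<nu> y) \<le> - \<nu> * (x - y)\<^sup>2"
    (is "(x - y) * (?f x - ?f y) \<le> _")
proof (cases "y \<le> x")
  case True
  then have "(x - y) * (?f x - ?f y) \<le> (x - y) * (- \<nu> * (x - y))"
    using fluid_drift_diff_le[OF assms True] by (intro mult_left_mono) auto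
  then show ?thesis
    by (simp add: power2_eq_square mult_ac)
next
  case False
  then have "(y - x) * (?f y - ?f x) \<le> (y - x) * (- \<nu> * (y - x))"
    using fluid_drift_diff_le[OF assms, of x y] by (intro mult_left_mono) auto
  then show ?thesis
    by (simp add: power2_eq_square algebra_simps)
qed

lemma fluid_drift_zero_unique:
  assumes "0 \<le> \<mu>" "0 < \<nu>"
    and "fluid_drift K M lam \<mu> \<nu> x = 0" "fluid_drift K M lam \<mu> \<nu> y = 0"
  shows "x = y"
proof -
  have "\<nu> * (x - y)\<^sup>2 \<le> 0"
    using fluid_drift_one_sided_Lipschitz[OF assms(1), of x y K M lam \<nu>] assms(3,4) by simp
  then show ?thesis
    using \<open>0 < \<nu>\<close> by (simp add: mult_le_0_iff)
qed

text \<open>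
  The two cases are the two linear pieces of the drift: in the first, the power capacity suffices
  to serve all uncharged vehicles in equilibrium; in the second, it is the bottleneck.
\<close>
lemma fluid_drift_has_positive_zero:
  assumes "0 < K" "0 < M" "0 < lam" "0 < \<mu>" "0 < \<nu>"
  obtains zs where "0 < zs" "fluid_drift K M lam \<mu> \<nu> zs = 0"
proof -
  define m where "m = min lam (\<nu> * K)"
  have "0 < m"
    using assms by (simp add: m_def)
  show thesis
  proof (cases "m \<le> (\<nu> + \<mu>) * M")
    case True
    then have "m / (\<nu> + \<mu>) \<le> M"
      using assms by (simp add: pos_divide_le_eq mult.commute)
    moreover have "\<nu> * (m / (\<nu> + \<mu>)) + \<mu> * (m / (\<nu> + \<mu>)) = m"
      using assms by (simp only: distrib_right[symmetric]) simp
    ultimately have "fluid_drift K M lam \<mu> \<nu> (m / (\<nu> + \<mu>)) = 0"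
      unfolding fluid_drift_def m_def[symmetric] by (simp only: min_absorb1)
    moreover have "0 < m / (\<nu> + \<mu>)"
      using assms \<open>0 < m\<close> by simp
    ultimately show thesis
      by (rule that[rotated])
  next
    case False
    then have "M \<le> (m - \<mu> * M) / \<nu>"
      using assms by (simp add: pos_le_divide_eq algebra_simps)
    moreover from this have "fluid_drift K M lam \<mu> \<nu> ((m - \<mu> * M) / \<nu>) = 0"
      using assms by (simp add: fluid_drift_def m_def[symmetric])
    ultimately show thesis
      using assms by (intro that[of "(m - \<mu> * M) / \<nu>"]) auto
  qed
qed

section \<open>Solutions of the differential equation\<close>

lemma satisfies_fluid_ode_until_DERIV:
  assumes "satisfies_fluid_ode_until K M lam \<mu> \<nu> z T" "0 < t" "ereal t < T"
  shows "(z has_real_derivative fluid_drift K M lam \<mu> \<nu> (z t)) (at t)"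
proof -
  have "at t within {0..} = at t"
    using \<open>0 < t\<close> by (intro at_within_interior) simp
  then show ?thesis
    using assms by (metis less_imp_le satisfies_fluid_ode_until_def)
qed

text \<open>
  Working with the weighted squared distance avoids a case distinction on the side of the
  equilibrium on which \<open>z\<close> lies, and keeps the quantity to be differentiated smooth.
\<close>
lemma fluid_ode_contraction:
  assumes "0 \<le> \<mu>" and cont: "continuous_on {0..} z"
    and ode: "satisfies_fluid_ode_until K M lam \<mu> \<nu> z \<infinity>"
    and zero: "fluid_drift K M lam \<mu> \<nu> zs = 0" and "0 \<le> t"
  shows "\<bar>z t - zs\<bar> \<le> \<bar>z 0 - zs\<bar> * exp (- \<nu> * t)"
proof -
  let ?f = "fluid_drift K M lam \<mu> \<nu>"
  define w where "w s = (z s - zs)\<^sup>2 * exp (2 * \<nu> * s)" for s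
  have "w t \<le> w 0"
  proof (rule DERIV_nonpos_imp_decreasing_open[OF \<open>0 \<le> t\<close>])
    fix s assume "0 < s" "s < t"
    have "(z has_real_derivative ?f (z s)) (at s)"
      using satisfies_fluid_ode_until_DERIV[OF ode \<open>0 < s\<close>] by simp
    then have "(w has_real_derivative
        2 * exp (2 * \<nu> * s) * ((z s - zs) * ?f (z s) + \<nu> * (z s - zs)\<^sup>2)) (at s)"
      unfolding w_def
      by (auto intro!: derivative_eq_intros simp: algebra_simps power2_eq_square)
    moreover have "(z s - zs) * ?f (z s) + \<nu> * (z s - zs)\<^sup>2 \<le> 0"
      using fluid_drift_one_sided_Lipschitz[OF \<open>0 \<le> \<mu>\<close>, of "z s" zs K M lam \<nu>] zero by simp
    ultimately show "\<exists>d. (w has_real_derivative d) (at s) \<and> d \<le> 0"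
      by (auto simp: mult_le_0_iff)
  next
    show "continuous_on {0..t} w"
      unfolding w_def by (intro continuous_intros continuous_on_subset[OF cont]) auto
  qed
  then have "(z t - zs)\<^sup>2 * (exp (\<nu> * t))\<^sup>2 \<le> (z 0 - zs)\<^sup>2"
    by (simp add: w_def exp_double[symmetric] mult_ac)
  then have "((z t - zs) * exp (\<nu> * t))\<^sup>2 \<le> (z 0 - zs)\<^sup>2"
    by (simp add: power_mult_distrib)
  then have "\<bar>z t - zs\<bar> * exp (\<nu> * t) \<le> \<bar>z 0 - zs\<bar>"
    by (simp add: abs_le_square_iff[symmetric] abs_mult)
  then show ?thesis
    by (simp add: exp_minus field_simps)
qed

text \<open>
  The bound reaches the closed end point \<open>T\<close>, although the equation is only assumed before \<open>T\<close>;
  this is what excludes that \<open>z\<close> vanishes at the hitting time.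
\<close>
lemma fluid_ode_stays_positive:
  assumes "0 \<le> lam" "0 \<le> \<nu> * K" "0 \<le> \<mu>" and cont: "continuous_on {0..} z"
    and ode: "satisfies_fluid_ode_until K M lam \<mu> \<nu> z (ereal T)"
    and "0 \<le> T" "0 < z 0"
  shows "0 < z T"
proof -
  let ?f = "fluid_drift K M lam \<mu> \<nu>"
  define g where "g s = z s * exp ((\<nu> + \<mu>) * s)" for s
  have "g 0 \<le> g T"
  proof (rule DERIV_nonneg_imp_increasing_open[OF \<open>0 \<le> T\<close>])
    fix s assume "0 < s" "s < T"
    have "(z has_real_derivative ?f (z s)) (at s)"
      using satisfies_fluid_ode_until_DERIV[OF ode \<open>0 < s\<close>] \<open>s < T\<close> by simp
    then have "(g has_real_derivative
        exp ((\<nu> + \<mu>) * s) * (?f (z s) + (\<nu> + \<mu>) * z s)) (at s)"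
      unfolding g_def by (auto intro!: derivative_eq_intros simp: algebra_simps)
    moreover have "0 \<le> ?f (z s) + (\<nu> + \<mu>) * z s"
    proof -
      have "\<mu> * min (z s) M \<le> \<mu> * z s"
        using \<open>0 \<le> \<mu>\<close> by (intro mult_left_mono) auto
      moreover have "0 \<le> min lam (\<nu> * K)"
        using assms(1,2) by simp
      ultimately show ?thesis
        unfolding fluid_drift_def distrib_right by linarith
    qed
    ultimately show "\<exists>d. (g has_real_derivative d) (at s) \<and> 0 \<le> d"
      by auto
  next
    show "continuous_on {0..T} g"
      unfolding g_def by (intro continuous_intros continuous_on_subset[OF cont]) auto
  qed
  then have "0 < z T * exp ((\<nu> + \<mu>) * T)"
    using \<open>0 < z 0\<close> by (simp add: g_def)
  then show ?thesis
    by (simp add: zero_less_mult_iff)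
qed

text \<open>
  By continuity the zeros of \<open>z\<close> form a closed set, so a finite hitting time would itself be a zero,
  against the positivity up to and including that time.
\<close>
lemma zero_hitting_time_infinite:
  assumes "0 \<le> lam" "0 \<le> \<nu> * K" "0 \<le> \<mu>" and cont: "continuous_on {0..} z"
    and ode: "satisfies_fluid_ode_until K M lam \<mu> \<nu> z (zero_hitting_time z)"
    and "0 < z 0"
  shows "zero_hitting_time z = \<infinity>"
proof -
  define S where "S = {s. 0 \<le> s \<and> z s = 0}"
  have "S = {}"
  proof (rule ccontr)
    assume "S \<noteq> {}"
    have bdd: "bdd_below S"
      by (auto simp: S_def intro: bdd_belowI[of _ 0])
    have "S = {0..} \<inter> z -` {0}"
      by (auto simp: S_def)
    then have "closed S"
      using continuous_on_closed_vimage[of "{0..}" z] cont by (auto simp: Int_commute)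
    then have "Inf S \<in> S"
      using \<open>S \<noteq> {}\<close> bdd by (intro closed_contains_Inf)
    then have "0 \<le> Inf S" "z (Inf S) = 0"
      by (auto simp: S_def)
    have "ereal (Inf S) \<le> zero_hitting_time z"
      unfolding zero_hitting_time_def S_def[symmetric]
      using bdd by (auto intro!: Inf_greatest cInf_lower)
    then have "satisfies_fluid_ode_until K M lam \<mu> \<nu> z (ereal (Inf S))"
      using ode unfolding satisfies_fluid_ode_until_def by (meson less_le_trans)
    then have "0 < z (Inf S)"
      using fluid_ode_stays_positive[OF assms(1-3) cont] \<open>0 \<le> Inf S\<close> \<open>0 < z 0\<close> by blast
    then show False
      using \<open>z (Inf S) = 0\<close> by simp
  qed
  then show ?thesis
    by (simp add: zero_hitting_time_def S_def[symmetric] top_ereal_def)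
qed

lemma fluid_trajectory_solves_ode_forever:
  assumes "0 \<le> lam" "0 \<le> \<nu> * K" "0 \<le> \<mu>" "0 \<le> z0"
    and "fluid_trajectory_from K M lam \<mu> \<nu> z0 z"
  shows "continuous_on {0..} z" "satisfies_fluid_ode_until K M lam \<mu> \<nu> z \<infinity>"
proof -
  show cont: "continuous_on {0..} z"
    using assms by (auto simp: fluid_trajectory_from_def fluid_model_solution_def fluid_path_def
        split: if_splits)
  show "satisfies_fluid_ode_until K M lam \<mu> \<nu> z \<infinity>"
  proof (cases "z0 = 0")
    case True
    then show ?thesis
      using assms by (simp add: fluid_trajectory_from_def)
  next
    case False
    then have ode: "satisfies_fluid_ode_until K M lam \<mu> \<nu> z (zero_hitting_time z)" and "0 < z 0"
      using assms by (auto simp: fluid_trajectory_from_def fluid_model_solution_def)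
    then show ?thesis
      using zero_hitting_time_infinite[OF assms(1-3) cont ode] by simp
  qed
qed

section \<open>Global exponential stability\<close>

theorem proposition4p2:
  fixes K M lam \<mu> \<nu> :: real
    and \<Omega> :: "'a measure"
    and B D :: "'a \<Rightarrow> real"
  assumes "0 < K" "0 < M" "M \<le> K" "0 < lam" "0 < \<mu>" "0 < \<nu>"
    and "prob_space \<Omega>"
    and "distributed \<Omega> lborel B (exponential_density \<mu>)"
    and "distributed \<Omega> lborel D (exponential_density \<nu>)"
    and "prob_space.indep_var \<Omega> borel B borel D"
  shows "\<exists>zs. (zs > 0 \<and>
            zs = min lam (\<nu> * K) * (\<integral>\<omega>. min (D \<omega>) (B \<omega> * max 1 (zs / M)) \<partial>\<Omega>)) \<and>
          (\<forall>y. y > 0 \<and>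
            y = min lam (\<nu> * K) * (\<integral>\<omega>. min (D \<omega>) (B \<omega> * max 1 (y / M)) \<partial>\<Omega>)
            \<longrightarrow> y = zs) \<and>
          (\<forall>z0\<in>{0..K}. \<forall>z. fluid_trajectory_from K M lam \<mu> \<nu> z0 z
            \<longrightarrow> converges_exponentially z zs)"
proof -
  interpret prob_space \<Omega>
    by fact
  obtain zs where zs: "0 < zs" "fluid_drift K M lam \<mu> \<nu> zs = 0"
    using fluid_drift_has_positive_zero assms(1,2,4,5,6) by blast
  have fixed_point:
    "y = min lam (\<nu> * K) * (\<integral>\<omega>. min (D \<omega>) (B \<omega> * max 1 (y / M)) \<partial>\<Omega>) \<longleftrightarrow>
      fluid_drift K M lam \<mu> \<nu> y = 0" if "0 < y" for y
    using fixed_point_iff_fluid_drift_zero[of M \<mu> \<nu> y lam K] assms that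
    by (subst expectation_min_scaled_exponential[of \<mu> \<nu> "max 1 (y / M)" B D]) auto
  have convergence: "converges_exponentially z zs"
    if "z0 \<in> {0..K}" "fluid_trajectory_from K M lam \<mu> \<nu> z0 z" for z0 z
  proof -
    note sol = fluid_trajectory_solves_ode_forever[OF _ _ _ _ that(2)]
    have "\<bar>z t - zs\<bar> \<le> \<bar>z 0 - zs\<bar> * exp (- \<nu> * t)" if "0 \<le> t" for t
      using assms \<open>z0 \<in> {0..K}\<close> zs that
      by (intro fluid_ode_contraction[of \<mu> z K M lam] sol) auto
    then show ?thesis
      using \<open>0 < \<nu>\<close> unfolding converges_exponentially_def by blast
  qed
  have "y = zs"
    if "0 < y" "y = min lam (\<nu> * K) * (\<integral>\<omega>. min (D \<omega>) (B \<omega> * max 1 (y / M)) \<partial>\<Omega>)" for y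
  proof -
    have "fluid_drift K M lam \<mu> \<nu> y = 0"
      using fixed_point[OF that(1)] that(2) by blast
    then show ?thesis
      using fluid_drift_zero_unique[of \<mu> \<nu> K M lam y zs] zs(2) assms(5,6) by simp
  qed
  then show ?thesis
    using zs fixed_point[OF zs(1)] convergence by blast
qed

end
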